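(* Let $a\in\mathbb{N}$ be a positive integer. Then there is $n_0=n_0(a)$ such that for every $n\ge n_0$ the $(a:a)$ Maker-Breaker perfect matching game $\mathcal{M}_n$ on $E(K_n)$ satisfies $$\tau_{\mathcal{M}_n}(a:a)=\begin{cases}\frac{n}{2a}+1, & \text{if } a=1 \text{ and } n \text{ is even},\\ \left\lceil \frac{n}{2a}\right\rceil-1, & \text{if } 2a\mid n-1,\\ \left\lceil \frac{n}{2a}\right\rceil, & \text{otherwise.}\end{cases}$$
   Context: In the $(a:a)$ Maker-Breaker game with board $X=E(K_n)$ (the edge set of the complete graph on $n$ vertices) and family of winning sets $\mathcal{F}\subseteq 2^X$, Breaker and Maker alternately claim $a$ previously unclaimed elements of $X$ per move (fewer if fewer remain), and Breaker moves first. Maker wins at the moment she has claimed all elements of some $F\in\mathcal{F}$ (this may happen before she has used all $a$ steps of her move); if she has not done so by the time all of $X$ is claimed, Breaker wins. $\tau_{\mathcal{F}}(a:a)$ denotes the least number of moves $t$ such that Maker has a strategy to win the $(a:a)$ game $\mathcal{F}$ within $t$ of her moves, against any strategy of Breaker ($\tau_{\mathcal F}(a:a)=\infty$ if Breaker has a winning strategy). In the perfect matching game $\mathcal{M}_n$ the winning sets are all sets of $\lfloor n/2\rfloor$ pairwise disjoint edges of $K_n$ (so for odd $n$ the matching covers all but one vertex). *)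

theory Defs
  imports Complex_Main "HOL-Library.Extended_Nat" "HOL-Library.Ramsey"
begin

text \<open>
  A history is the list of completed rounds, each a pair of the set claimed by Breaker (who moves
  first) and the set then claimed by Maker. The elements of one move are recorded as a set: their
  order is irrelevant because the opponent does not act in between. Play goes on formally after
  Maker has completed a winning set; as she never loses elements, she has won by the end of her
  \<open>t\<close>-th move iff her elements contain a winning set after \<open>t\<close> rounds, whether or not
  this already happened in the middle of a move. Boards are meant to be finite.
\<close>

type_synonym 'e history = "('e set \<times> 'e set) list"
type_synonym 'e breaker_strategy = "'e history \<Rightarrow> 'e set"
type_synonym 'e maker_strategy = "'e history \<Rightarrow> 'e set \<Rightarrow> 'e set"

definition claimed :: "'e history \<Rightarrow> 'e set" where
  "claimed h = (\<Union>(B, M) \<in> set h. B \<union> M)"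

definition maker_claimed :: "'e history \<Rightarrow> 'e set" where
  "maker_claimed h = (\<Union>(B, M) \<in> set h. M)"

definition legal_move :: "nat \<Rightarrow> 'e set \<Rightarrow> 'e set \<Rightarrow> 'e set \<Rightarrow> bool" where
  "legal_move a X C S \<longleftrightarrow> S \<subseteq> X - C \<and> card S = min a (card (X - C))"

definition is_breaker_strategy :: "nat \<Rightarrow> 'e set \<Rightarrow> 'e breaker_strategy \<Rightarrow> bool" where
  "is_breaker_strategy a X \<beta> \<longleftrightarrow> (\<forall>h. legal_move a X (claimed h) (\<beta> h))"

text \<open>Maker's strategy also sees Breaker's move \<open>B\<close> in the current round.\<close>

definition is_maker_strategy :: "nat \<Rightarrow> 'e set \<Rightarrow> 'e maker_strategy \<Rightarrow> bool" where
  "is_maker_strategy a X \<mu> \<longleftrightarrow> (\<forall>h B. legal_move a X (claimed h \<union> B) (\<mu> h B))"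

primrec play :: "'e breaker_strategy \<Rightarrow> 'e maker_strategy \<Rightarrow> nat \<Rightarrow> 'e history" where
  "play \<beta> \<mu> 0 = []"
| "play \<beta> \<mu> (Suc t) = (let h = play \<beta> \<mu> t; B = \<beta> h in h @ [(B, \<mu> h B)])"

definition maker_wins_within :: "nat \<Rightarrow> 'e set \<Rightarrow> 'e set set \<Rightarrow> nat \<Rightarrow> bool" where
  "maker_wins_within a X \<F> t \<longleftrightarrow>
     (\<exists>\<mu>. is_maker_strategy a X \<mu> \<and>
       (\<forall>\<beta>. is_breaker_strategy a X \<beta> \<longrightarrow> (\<exists>F\<in>\<F>. F \<subseteq> maker_claimed (play \<beta> \<mu> t))))"

text \<open>The infimum of the empty set in \<^typ>\<open>enat\<close> is \<open>\<infinity>\<close>. On a finite board the game is finite,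
  hence determined, so this value is taken exactly when Breaker has a winning strategy.\<close>

definition tau :: "nat \<Rightarrow> 'e set \<Rightarrow> 'e set set \<Rightarrow> enat" where
  "tau a X \<F> = Inf (enat ` {t. maker_wins_within a X \<F> t})"

definition complete_edges :: "nat \<Rightarrow> nat set set" where
  "complete_edges n = nsets {..<n} 2"

definition perfect_matching_game :: "nat \<Rightarrow> nat set set set" where
  "perfect_matching_game n =
     {P. P \<subseteq> complete_edges n \<and> card P = n div 2 \<and> pairwise disjnt P}"

end

theory Submission
  imports Defs
begin

text \<open>
  Counting gives the lower bound. For the upper bound Maker matches fresh vertices so that after each
  of her moves no Breaker edge lies inside the set of unmatched vertices: \<open>a\<close> edges always
  have a vertex cover of size \<open>a\<close>, whose vertices she matches with harmless partners. For
  \<open>a \<ge> 2\<close> even \<open>a - 1\<close> edges meet all \<open>a\<close> new Breaker edges, which leaves her the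
  freedom to complete the matching in the last round. For \<open>a = 1\<close> and even \<open>n\<close> she needs a
  double threat at the end, which she prepares by starting with a path of length two.
\<close>

section \<open>Matchings and the vertices they cover\<close>

definition matching_on :: "'v set \<Rightarrow> nat \<Rightarrow> 'v set set \<Rightarrow> bool" where
  "matching_on V k D \<longleftrightarrow> D \<subseteq> nsets V 2 \<and> pairwise disjnt D \<and> card D = k"

lemma perfect_matching_game_iff:
  "P \<in> perfect_matching_game n \<longleftrightarrow> matching_on {..<n} (n div 2) P"
  by (auto simp: perfect_matching_game_def matching_on_def complete_edges_def)

lemma matching_on_empty: "matching_on V 0 {}"
  by (simp add: matching_on_def)

lemma matching_on_subset: "matching_on V k D \<Longrightarrow> D \<subseteq> nsets V 2"
  by (simp add: matching_on_def)

lemma matching_on_card: "matching_on V k D \<Longrightarrow> card D = k"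
  by (simp add: matching_on_def)

lemma matching_on_Union: "matching_on V k D \<Longrightarrow> \<Union>D \<subseteq> V"
  by (auto simp: matching_on_def nsets_def)

lemma matching_on_mono: "matching_on V k D \<Longrightarrow> V \<subseteq> V' \<Longrightarrow> matching_on V' k D"
  unfolding matching_on_def nsets_def by blast

lemma card_Union_matching:
  assumes "matching_on V k D"
  shows "card (\<Union>D) = 2 * k"
proof -
  have "card (\<Union>D) = sum card D"
    using assms by (intro card_Union_disjoint) (auto simp: matching_on_def nsets_def)
  also have "\<dots> = sum (\<lambda>_. 2) D"
    using assms by (intro sum.cong) (auto simp: matching_on_def nsets_def)
  finally show ?thesis using assms by (simp add: matching_on_def)
qed

lemma card_Diff_matching:
  assumes "matching_on V k D" "finite V"
  shows "card (V - \<Union>D) = card V - 2 * k"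
  using assms matching_on_Union[OF assms(1)] card_Union_matching[OF assms(1)]
  by (simp add: card_Diff_subset finite_subset)

lemma matching_on_Un:
  assumes "matching_on V k D" "matching_on V' k' D'" "V \<union> V' \<subseteq> U" "V' \<inter> \<Union>D = {}" "finite U"
  shows "matching_on U (k + k') (D \<union> D')"
proof -
  have sub: "D \<subseteq> nsets U 2" "D' \<subseteq> nsets V' 2" "D' \<subseteq> nsets U 2"
    using assms unfolding matching_on_def nsets_def by blast+
  have cross: "disjnt d d'" if "d \<in> D" "d' \<in> D'" for d d'
    using that sub assms(4) unfolding nsets_def disjnt_def by blast
  have "D \<inter> D' = {}"
    using cross sub unfolding nsets_def disjnt_def by fastforce
  moreover have "finite D" "finite D'"
    using sub finite_imp_finite_nsets[OF assms(5)] finite_subset by blast+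
  ultimately have "card (D \<union> D') = k + k'"
    using assms by (simp add: card_Un_disjoint matching_on_def)
  moreover have "pairwise disjnt (D \<union> D')"
    using cross assms(1,2) unfolding matching_on_def pairwise_def
    by (metis Un_iff disjnt_sym)
  ultimately show ?thesis
    using sub by (simp add: matching_on_def)
qed

lemma matching_on_insert:
  assumes "matching_on V k D" "u \<in> U" "w \<in> U" "u \<noteq> w" "u \<notin> \<Union>D" "w \<notin> \<Union>D" "V \<subseteq> U" "finite U"
  shows "matching_on U (Suc k) (insert {u, w} D)"
proof -
  have "matching_on {u, w} 1 {{u, w}}"
    using assms(4) by (simp add: matching_on_def)
  from matching_on_Un[OF assms(1) this, of U] show ?thesis
    using assms by simp
qed

section \<open>Small matchings that meet given edges\<close>

text \<open>The map sending \<open>w\<close> to \<open>{u, w}\<close> is injective, so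
  \<open>G\<close> rules out at most \<open>card G\<close> partners of \<open>u\<close>, and
  \<open>A\<close> at most \<open>card A\<close> more.\<close>

lemma ex_partner:
  fixes V :: "'v set"
  assumes "finite V" "finite G" "card G + card A < card V" "finite A"
  shows "\<exists>w\<in>V. w \<notin> A \<and> {u, w} \<notin> G"
proof (rule ccontr)
  assume "\<not> ?thesis"
  then have "V \<subseteq> A \<union> {w. {u, w} \<in> G}" by blast
  moreover have inj: "inj_on (\<lambda>w. {u, w}) {w. {u, w} \<in> G}"
    by (auto simp: inj_on_def doubleton_eq_iff)
  have sub: "(\<lambda>w. {u, w}) ` {w. {u, w} \<in> G} \<subseteq> G" by auto
  have "card {w. {u, w} \<in> G} \<le> card G"
    using card_inj_on_le[OF inj sub assms(2)] .
  moreover have "finite {w. {u, w} \<in> G}"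
    using inj_on_finite[OF inj sub assms(2)] .
  ultimately have "card V \<le> card A + card G"
    by (smt (verit) add_left_mono assms(4) card_Un_le card_mono finite_Un le_trans)
  then show False using assms(3) by simp
qed

text \<open>The second alternative gains one edge because a single edge can meet two given edges.\<close>

lemma ex_covering_matching:
  fixes V :: "'v set"
  assumes "finite V" "finite G" "\<And>g. g \<in> G \<Longrightarrow> g \<inter> V \<noteq> {}"
    and "card G \<le> j \<and> 2 * j + 1 \<le> card V \<or> card G \<le> j + 1 \<and> 2 * j + 2 \<le> card V \<and> 1 \<le> j"
  shows "\<exists>D. matching_on V j D \<and> D \<inter> G = {} \<and> (\<forall>g\<in>G. g \<inter> \<Union>D \<noteq> {})"
  using assms
proof (induction j arbitrary: V G)
  case 0
  then show ?case using matching_on_empty by fastforce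
next
  case (Suc j)
  show ?case
  \<comment> \<open>This case is where the gain arises: one edge has to meet two sets, through a
    common vertex in \<open>V\<close> if there is one and otherwise through one vertex of
    each.\<close>
  proof (cases "j = 0 \<and> card G = 2")
    case True
    then obtain g1 g2 where G: "G = {g1, g2}" "g1 \<noteq> g2"
      by (meson card_2_iff)
    have cV: "4 \<le> card V" using Suc.prems(4) True by auto
    obtain u w where uw: "u \<in> V" "w \<in> V" "u \<noteq> w" "{u, w} \<notin> G" "\<forall>g\<in>G. u \<in> g \<or> w \<in> g"
    proof (cases "g1 \<inter> g2 \<inter> V = {}")
      case False
      then obtain u where u: "u \<in> g1" "u \<in> g2" "u \<in> V" by blast
      obtain w where "w \<in> V" "w \<notin> {u}" "{u, w} \<notin> G"
        using ex_partner[OF Suc.prems(1,2), of "{u}" u] cV True by auto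
      then show thesis using that[of u w] u G by auto
    next
      case True
      have "g1 \<inter> V \<noteq> {}" "g2 \<inter> V \<noteq> {}" using Suc.prems(3) G(1) by simp_all
      then obtain u w where u: "u \<in> g1" "u \<in> V" and w: "w \<in> g2" "w \<in> V" by auto
      have "u \<noteq> w" "{u, w} \<notin> G" using True u w G by auto
      then show thesis using that[of u w] u w G by auto
    qed
    have "matching_on V (Suc 0) {{u, w}}"
      using matching_on_insert[OF matching_on_empty[of V], of u V w] uw Suc.prems(1) by simp
    then show ?thesis using uw True by (intro exI[of _ "{{u, w}}"]) auto
  next
    case False
    obtain u where u: "u \<in> V" "G \<noteq> {} \<Longrightarrow> \<exists>g\<in>G. u \<in> g"
    proof (cases "G = {}")
      case True
      then show thesis using that Suc.prems(4)
        by (metis card.empty ex_in_conv add_is_0 le_zero_eq one_neq_zero zero_neq_numeral)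
    next
      case False
      then show thesis using that Suc.prems(3) by blast
    qed
    \<comment> \<open>The edge \<open>{u, w}\<close> disposes of some member of \<open>G\<close>
      through \<open>u\<close> at the cost of two vertices; the induction hypothesis handles the
      rest.\<close>
    obtain w where w: "w \<in> V" "w \<noteq> u" "{u, w} \<notin> G"
      using ex_partner[OF Suc.prems(1,2), of "{u}" u] Suc.prems(4) by auto
    define G' where "G' = {g\<in>G. u \<notin> g \<and> w \<notin> g}"
    define V' where "V' = V - {u, w}"
    have fin: "finite V'" "finite G'" using Suc.prems by (auto simp: V'_def G'_def)
    have cV': "card V' = card V - 2"
      using u w Suc.prems(1) by (simp add: V'_def card_Diff_subset)
    have cG': "card G' \<le> card G - 1"
    proof (cases "G = {}")
      case False
      then obtain g where "g \<in> G" "u \<in> g" using u by blast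
      then have "G' \<subset> G" by (auto simp: G'_def)
      then have "card G' < card G" using psubset_card_mono[OF Suc.prems(2)] by blast
      then show ?thesis by simp
    qed (simp add: G'_def)
    have meet: "g \<inter> V' \<noteq> {}" if "g \<in> G'" for g
      using that Suc.prems(3)[of g] by (auto simp: V'_def G'_def)
    \<comment> \<open>For \<open>j = 0\<close> the second alternative is lost, but then
      \<open>card G\<close> is at most 1, so \<open>G'\<close> is empty and the first alternative
      holds.\<close>
    have "card G' \<le> j \<and> 2 * j + 1 \<le> card V' \<or> card G' \<le> j + 1 \<and> 2 * j + 2 \<le> card V' \<and> 1 \<le> j"
      using Suc.prems(4) cG' cV' False by auto
    from Suc.IH[OF fin meet this] obtain D where
      D: "matching_on V' j D" "D \<inter> G' = {}" "\<forall>g\<in>G'. g \<inter> \<Union>D \<noteq> {}" by blast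
    have DV: "\<Union>D \<subseteq> V - {u, w}" using matching_on_Union[OF D(1)] by (simp add: V'_def)
    have "matching_on V (Suc j) (insert {u, w} D)"
      by (rule matching_on_insert[OF D(1)]) (use DV u w Suc.prems(1) in \<open>auto simp: V'_def\<close>)
    moreover have "insert {u, w} D \<inter> G = {}"
      using D(2) DV w(3) by (auto simp: G'_def)
    moreover have "\<forall>g\<in>G. g \<inter> \<Union>(insert {u, w} D) \<noteq> {}"
      using D(3) by (fastforce simp: G'_def)
    ultimately show ?thesis by blast
  qed
qed

text \<open>Maker's answer in one round. For \<open>a = 1\<close> the plain covering is used. For
  larger \<open>a\<close> the gain makes \<open>a - 1\<close> edges suffice; if \<open>a\<close> are
  wanted, two uncovered vertices are joined as well.\<close>

lemma ex_round_matching: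
  fixes V :: "'v set"
  assumes "finite V" "finite G" "\<And>g. g \<in> G \<Longrightarrow> g \<inter> V \<noteq> {}" "card G \<le> a" "1 \<le> a"
    and "j = a \<or> 2 \<le> a \<and> j = a - 1" "2 * a + (if a = 1 then 1 else 0) \<le> card V"
  shows "\<exists>D. matching_on V j D \<and> D \<inter> G = {} \<and> (\<forall>g\<in>G. g \<inter> \<Union>D \<noteq> {})"
proof (cases "a = 1")
  case True
  then show ?thesis using assms by (intro ex_covering_matching) auto
next
  case False
  then have "\<exists>D. matching_on V (a - 1) D \<and> D \<inter> G = {} \<and> (\<forall>g\<in>G. g \<inter> \<Union>D \<noteq> {})"
    using assms by (intro ex_covering_matching) auto
  then obtain D where D: "matching_on V (a - 1) D" "D \<inter> G = {}" "\<forall>g\<in>G. g \<inter> \<Union>D \<noteq> {}"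
    by blast
  show ?thesis
  proof (cases "j = a")
    case True
    have "2 \<le> card (V - \<Union>D)"
      using card_Diff_matching[OF D(1) assms(1)] assms(5,7) False by simp
    then obtain T where "T \<subseteq> V - \<Union>D" "card T = 2"
      by (meson obtain_subset_with_card_n)
    then obtain u w where uw: "u \<in> V" "w \<in> V" "u \<noteq> w" "u \<notin> \<Union>D" "w \<notin> \<Union>D"
      by (auto simp: card_2_iff)
    \<comment> \<open>Every member of \<open>G\<close> meets the vertices covered by
      \<open>D\<close>, whereas \<open>{u, w}\<close> avoids them.\<close>
    then have "{u, w} \<inter> \<Union>D = {}" by simp
    then have "{u, w} \<notin> G" using D(3) by metis
    moreover have "matching_on V a (insert {u, w} D)"
      using matching_on_insert[OF D(1) uw(1-5) order_refl assms(1)] assms(5) by simp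
    ultimately show ?thesis
      using D True by (intro exI[of _ "insert {u, w} D"]) auto
  next
    case False
    then show ?thesis using D assms(6) by auto
  qed
qed

section \<open>From a relaxed game to strategies\<close>

text \<open>A relaxation of the game in which Maker may claim fewer edges and Breaker may even claim
  edges of Maker; neither matters, as extra edges do not hurt Maker and she never loses hers.\<close>

primrec winnable :: "nat \<Rightarrow> 'e set \<Rightarrow> 'e set set \<Rightarrow> nat \<Rightarrow> 'e set \<Rightarrow> 'e set \<Rightarrow> bool" where
  "winnable a X \<F> 0 Bs Ms \<longleftrightarrow> (\<exists>F\<in>\<F>. F \<subseteq> Ms)"
| "winnable a X \<F> (Suc k) Bs Ms \<longleftrightarrow>
     (\<forall>B. finite B \<and> card B \<le> a \<longrightarrow>
       (\<exists>D\<subseteq>X. card D \<le> a \<and> D \<inter> (Bs \<union> B) = {} \<and> winnable a X \<F> k (Bs \<union> B) (Ms \<union> D)))"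

lemma winnable_mono:
  "winnable a X \<F> k Bs Ms \<Longrightarrow> Ms \<subseteq> Ms' \<Longrightarrow> winnable a X \<F> k Bs Ms'"
proof (induction k arbitrary: Bs Ms Ms')
  case 0
  then show ?case by (metis winnable.simps(1) order_trans)
next
  case (Suc k)
  show ?case
  proof (simp, intro allI impI)
    fix B :: "'a set" assume "finite B \<and> card B \<le> a"
    then obtain D where "D \<subseteq> X" "card D \<le> a" "D \<inter> (Bs \<union> B) = {}"
      "winnable a X \<F> k (Bs \<union> B) (Ms \<union> D)" using Suc.prems(1) by auto
    moreover from this have "winnable a X \<F> k (Bs \<union> B) (Ms' \<union> D)"
      using Suc.IH Suc.prems(2) by (metis Un_mono order_refl)
    ultimately show "\<exists>D\<subseteq>X. card D \<le> a \<and> D \<inter> (Bs \<union> B) = {} \<and> winnable a X \<F> k (Bs \<union> B) (Ms' \<union> D)"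
      by blast
  qed
qed

declare winnable.simps [simp del]

definition breaker_claimed :: "'e history \<Rightarrow> 'e set" where
  "breaker_claimed h = (\<Union>(B, M) \<in> set h. B)"

lemma claimed_eq: "claimed h = breaker_claimed h \<union> maker_claimed h"
  by (auto simp: claimed_def breaker_claimed_def maker_claimed_def)

lemma claimed_snoc:
  "breaker_claimed (h @ [(B, M)]) = breaker_claimed h \<union> B"
  "maker_claimed (h @ [(B, M)]) = maker_claimed h \<union> M"
  by (auto simp: breaker_claimed_def maker_claimed_def)

lemma claimed_Nil: "breaker_claimed [] = {}" "maker_claimed [] = {}"
  by (auto simp: breaker_claimed_def maker_claimed_def)

lemma play_Suc:
  "breaker_claimed (play \<beta> \<mu> (Suc t)) = breaker_claimed (play \<beta> \<mu> t) \<union> \<beta> (play \<beta> \<mu> t)"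
  "maker_claimed (play \<beta> \<mu> (Suc t)) =
     maker_claimed (play \<beta> \<mu> t) \<union> \<mu> (play \<beta> \<mu> t) (\<beta> (play \<beta> \<mu> t))"
  by (simp_all add: Let_def claimed_snoc)

lemma length_play: "length (play \<beta> \<mu> t) = t"
  by (induction t) (simp_all add: Let_def)

text \<open>Moves have a prescribed size; this pads the edges Maker cares about to a legal
  move.\<close>

lemma legal_move_extend:
  assumes "finite X" "S \<subseteq> X - C" "card S \<le> a"
  shows "\<exists>M. legal_move a X C M \<and> S \<subseteq> M"
proof -
  have "card S \<le> min a (card (X - C))"
    using assms by (simp add: card_mono)
  then obtain M where "S \<subseteq> M" "M \<subseteq> X - C" "card M = min a (card (X - C))"
    using exists_subset_between[of S "min a (card (X - C))" "X - C"] assms by auto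
  then show ?thesis by (auto simp: legal_move_def)
qed

lemma ex_legal_move: "finite X \<Longrightarrow> \<exists>M. legal_move a X C M"
  using legal_move_extend[of X "{}" C a] by auto

text \<open>Maker chooses a legal move that keeps the relaxed position winnable in the remaining
  rounds. Along any play this is an invariant, and with no rounds left it says that she has
  won.\<close>

lemma maker_wins_withinI:
  fixes X :: "'e set"
  assumes "finite X" and win: "winnable a X \<F> T {} {}"
  shows "maker_wins_within a X \<F> T"
proof -
  \<comment> \<open>A strategy must be legal on every history, also on those that never arise; where
    no good move exists, \<open>\<mu>\<close> falls back on any legal one.\<close>
  define good where "good h B M \<longleftrightarrow> legal_move a X (claimed h \<union> B) M \<and>
    winnable a X \<F> (T - length h - 1) (breaker_claimed h \<union> B) (maker_claimed h \<union> M)"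
    for h :: "'e history" and B M
  define \<mu> where "\<mu> h B = (if Ex (good h B) then SOME M. good h B M
    else SOME M. legal_move a X (claimed h \<union> B) M)" for h B
  have legal: "legal_move a X (claimed h \<union> B) (\<mu> h B)" for h B
  proof (cases "Ex (good h B)")
    case True
    then have "good h B (\<mu> h B)" by (simp add: \<mu>_def someI_ex)
    then show ?thesis by (simp add: good_def)
  next
    case False
    show ?thesis unfolding \<mu>_def if_not_P[OF False] by (rule someI_ex[OF ex_legal_move[OF assms(1)]])
  qed
  have "winnable a X \<F> (T - t) (breaker_claimed (play \<beta> \<mu> t)) (maker_claimed (play \<beta> \<mu> t))"
    if \<beta>: "is_breaker_strategy a X \<beta>" and "t \<le> T" for \<beta> t
    using that(2)
  proof (induction t)
    case 0
    then show ?case using win by (simp add: claimed_Nil)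
  next
    case (Suc t)
    define h where "h = play \<beta> \<mu> t"
    define B where "B = \<beta> h"
    have "legal_move a X (claimed h) B"
      using \<beta> by (simp add: is_breaker_strategy_def B_def)
    then have B: "finite B \<and> card B \<le> a"
      using finite_subset[of B X] assms(1) by (auto simp: legal_move_def)
    have "T - t = Suc (T - t - 1)" using Suc.prems by simp
    then have "winnable a X \<F> (Suc (T - t - 1)) (breaker_claimed h) (maker_claimed h)"
      using Suc by (simp add: h_def)
    then obtain D where D: "D \<subseteq> X" "card D \<le> a" "D \<inter> (breaker_claimed h \<union> B) = {}"
      "winnable a X \<F> (T - t - 1) (breaker_claimed h \<union> B) (maker_claimed h \<union> D)"
      using B by (auto simp: winnable.simps)
    \<comment> \<open>The relaxed move \<open>D\<close> avoids only Breaker's edges. Edges Maker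
      already owns are removed before padding; she keeps them anyway.\<close>
    have "card (D - maker_claimed h) \<le> a"
      using D(1,2) card_mono[of D "D - maker_claimed h"] finite_subset[OF _ assms(1)] by fastforce
    moreover have "D - maker_claimed h \<subseteq> X - (claimed h \<union> B)"
      using D by (auto simp: claimed_eq)
    ultimately obtain M where M: "legal_move a X (claimed h \<union> B) M" "D - maker_claimed h \<subseteq> M"
      using legal_move_extend[OF assms(1)] by meson
    have "winnable a X \<F> (T - t - 1) (breaker_claimed h \<union> B) (maker_claimed h \<union> M)"
      using winnable_mono[OF D(4)] M(2) by blast
    then have "good h B M"
      using M(1) by (simp add: good_def h_def length_play)
    then have "Ex (good h B)" by blast
    then have "good h B (\<mu> h B)" by (simp add: \<mu>_def someI_ex)
    then show ?case
      by (simp add: good_def h_def B_def play_Suc length_play del: play.simps)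
  qed
  then have "\<exists>F\<in>\<F>. F \<subseteq> maker_claimed (play \<beta> \<mu> T)" if "is_breaker_strategy a X \<beta>" for \<beta>
    using that by (metis diff_self_eq_0 order_refl winnable.simps(1))
  then show ?thesis
    using legal unfolding maker_wins_within_def is_maker_strategy_def by blast
qed

section \<open>Rounds that leave no threats\<close>

text \<open>The Breaker edges that could still hinder Maker from matching \<open>V\<close>, when \<open>W\<close> is a set of
  vertices which are already used but to which one vertex of \<open>V\<close> shall finally be joined.\<close>

definition threats :: "'v set \<Rightarrow> 'v set \<Rightarrow> 'v set set \<Rightarrow> 'v set set" where
  "threats V W Bs = {e\<in>Bs. e \<subseteq> V \<union> W \<and> e \<inter> V \<noteq> {}}"

lemma threats_subset: "threats V W Bs \<subseteq> Bs"
  by (auto simp: threats_def)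

lemma threats_Un: "threats V W (Bs \<union> B) = threats V W Bs \<union> threats V W B"
  by (auto simp: threats_def)

text \<open>A threat to \<open>V - A\<close> would also be a threat to \<open>V\<close> and hence
  meet \<open>A\<close>, but it lies inside \<open>(V - A) \<union> W\<close>, which is disjoint
  from \<open>A\<close>.\<close>

lemma threats_Diff:
  assumes "\<And>g. g \<in> threats V W Bs \<Longrightarrow> g \<inter> A \<noteq> {}" "A \<subseteq> V" "V \<inter> W = {}"
  shows "threats (V - A) W Bs = {}"
  using assms unfolding threats_def by blast

text \<open>A Breaker edge inside \<open>V\<close> is itself a threat, so a matching of
  \<open>V\<close> avoiding the threats avoids all of Breaker's edges.\<close>

lemma matching_Int_threats:
  assumes "matching_on V k D" "D \<inter> threats V W Bs = {}"
  shows "D \<inter> Bs = {}"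
proof -
  have "d \<subseteq> V" "d \<inter> V \<noteq> {}" if "d \<in> D" for d
  proof -
    have "d \<subseteq> V" "card d = 2" using that assms(1) by (auto simp: matching_on_def nsets_def)
    moreover from this have "d \<noteq> {}" by auto
    ultimately show "d \<subseteq> V" "d \<inter> V \<noteq> {}" by blast+
  qed
  then show ?thesis using assms(2) unfolding threats_def by blast
qed

text \<open>Plays \<open>k\<close> rounds of \<open>j\<close> edges each, with absence of threats as
  invariant; the last hypothesis takes over for the remaining \<open>r\<close> rounds. The summand
  \<open>2 * (a - j)\<close> ensures that even the last of the \<open>k\<close> rounds starts with
  \<open>2 * a\<close> vertices, or 3 if \<open>a = 1\<close>.\<close>

lemma winnable_phase:
  assumes "finite V" "nsets V 2 \<subseteq> X" "V \<inter> W = {}" "threats V W Bs = {}"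
    and "1 \<le> a" "j = a \<or> 2 \<le> a \<and> j = a - 1"
    and "2 * j * k + 2 * (a - j) + (if a = 1 then 1 else 0) \<le> card V"
    and "\<And>D Bs'. matching_on V (j * k) D \<Longrightarrow> threats (V - \<Union>D) W Bs' = {} \<Longrightarrow>
           winnable a X \<F> r Bs' (Ms \<union> D)"
  shows "winnable a X \<F> (k + r) Bs Ms"
  using assms
proof (induction k arbitrary: V Bs Ms)
  case 0
  then show ?case using matching_on_empty by fastforce
next
  case (Suc k)
  show ?case
  proof (simp add: winnable.simps, intro allI impI)
    fix B :: "'a set set" assume B: "finite B \<and> card B \<le> a"
    define G where "G = threats V W (Bs \<union> B)"
    \<comment> \<open>By the invariant only Breaker's latest move creates threats, so there are at
      most \<open>a\<close>.\<close>
    have G: "G = threats V W B" using Suc.prems(4) by (simp add: G_def threats_Un)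
    then have G_le: "finite G" "card G \<le> a"
      using B threats_subset[of V W B] by (auto intro: finite_subset card_mono[THEN order_trans])
    have G_meet: "g \<inter> V \<noteq> {}" if "g \<in> G" for g using that by (auto simp: G_def threats_def)
    have cV: "2 * a + (if a = 1 then 1 else 0) \<le> card V"
      using Suc.prems(6,7) by auto
    obtain D where D: "matching_on V j D" "D \<inter> G = {}" "\<forall>g\<in>G. g \<inter> \<Union>D \<noteq> {}"
      using ex_round_matching[OF Suc.prems(1) G_le(1) G_meet G_le(2) Suc.prems(5,6) cV] by blast
    have DX: "D \<subseteq> X" using matching_on_subset[OF D(1)] Suc.prems(2) by blast
    have cD: "card D \<le> a" using matching_on_card[OF D(1)] Suc.prems(6) by auto
    have DB: "D \<inter> (Bs \<union> B) = {}" using matching_Int_threats D by (metis G_def)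
    have "winnable a X \<F> (k + r) (Bs \<union> B) (Ms \<union> D)"
    proof (rule Suc.IH)
      show "finite (V - \<Union>D)" "nsets (V - \<Union>D) 2 \<subseteq> X" "(V - \<Union>D) \<inter> W = {}"
        using Suc.prems(1-3) by (auto simp: nsets_def)
      show "threats (V - \<Union>D) W (Bs \<union> B) = {}"
        using D(3) matching_on_Union[OF D(1)] Suc.prems(3) by (intro threats_Diff) (auto simp: G_def)
      show "1 \<le> a" "j = a \<or> 2 \<le> a \<and> j = a - 1" by fact+
      show "2 * j * k + 2 * (a - j) + (if a = 1 then 1 else 0) \<le> card (V - \<Union>D)"
        using Suc.prems(7) by (simp add: card_Diff_matching[OF D(1) Suc.prems(1)])
    next
      fix D' Bs'
      assume D': "matching_on (V - \<Union>D) (j * k) D'" "threats (V - \<Union>D - \<Union>D') W Bs' = {}"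
      have "matching_on V (j * Suc k) (D \<union> D')"
        using matching_on_Un[OF D(1) D'(1), of V] Suc.prems(1) by auto
      moreover have "threats (V - \<Union>(D \<union> D')) W Bs' = {}"
        using D'(2) by (simp add: Un_Diff Diff_Un Diff_Int2 set_diff_eq)
      ultimately show "winnable a X \<F> r Bs' (Ms \<union> D \<union> D')"
        using Suc.prems(8) by (simp add: Un_assoc)
    qed
    then show "\<exists>D\<subseteq>X. card D \<le> a \<and> D \<inter> (Bs \<union> B) = {} \<and> winnable a X \<F> (k + r) (Bs \<union> B) (Ms \<union> D)"
      using DX cD DB by blast
  qed
qed

section \<open>Upper bound for larger moves or odd order\<close>

lemma finite_complete_edges: "finite (complete_edges n)"
  by (simp add: complete_edges_def finite_imp_finite_nsets)

text \<open>Maker can afford \<open>s = T * a - n div 2\<close> superfluous edges; she wastes them one per round in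
  the first \<open>s\<close> rounds, so that Breaker faces at least \<open>2 * a\<close> unmatched vertices in every round.\<close>

lemma perfect_matching_upper:
  assumes "1 \<le> a" "2 \<le> a \<or> odd n" "a \<le> T" "n div 2 \<le> T * a" "T * a < n div 2 + a"
  shows "maker_wins_within a (complete_edges n) (perfect_matching_game n) T"
proof (rule maker_wins_withinI[OF finite_complete_edges])
  define s where "s = T * a - n div 2"
  have s: "s < a" "s < T" using assms by (auto simp: s_def)
  \<comment> \<open>The edges of \<open>s\<close> rounds with one wasted edge and
    \<open>T - s\<close> full rounds add up to exactly a perfect matching.\<close>
  have sum: "(a - 1) * s + a * (T - s) = n div 2"
  proof -
    have "T * a = s * a + (T - s) * a"
      using s by (simp flip: add_mult_distrib)
    moreover have "(a - 1) * s + s = s * a"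
      using assms(1) by (cases a) auto
    moreover have "T * a = n div 2 + s"
      using assms(4) by (simp add: s_def)
    ultimately show ?thesis by (simp add: mult.commute)
  qed
  let ?win = "winnable a (complete_edges n) (perfect_matching_game n)"
  have "?win (s + (T - s)) {} {}"
  \<comment> \<open>For \<open>a = 1\<close> we have \<open>s = 0\<close>, so the first phase is
    void; \<open>j = a\<close> then satisfies the side condition on \<open>j\<close>.\<close>
  proof (rule winnable_phase[where V = "{..<n}" and W = "{}" and j = "if a = 1 then a else a - 1"])
    show "2 * (if a = 1 then a else a - 1) * s + 2 * (a - (if a = 1 then a else a - 1))
        + (if a = 1 then 1 else 0) \<le> card {..<n}"
    proof (cases "a = 1")
      case True
      then show ?thesis using s assms by (auto elim!: oddE)
    next
      case False
      \<comment> \<open>Since \<open>s < T\<close>, a full round is still to come, and its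
        \<open>2 * a\<close> vertices provide the slack.\<close>
      have "a \<le> a * (T - s)" using s by simp
      then have "2 * ((a - 1) * s) + 2 * a \<le> n" using sum by linarith
      then show ?thesis using False assms(1) by (simp add: mult.assoc)
    qed
  next
    fix D Bs'
    assume D: "matching_on {..<n} ((if a = 1 then a else a - 1) * s) D"
      "threats ({..<n} - \<Union>D) {} Bs' = {}"
    then have D': "matching_on {..<n} ((a - 1) * s) D" using s by (auto split: if_splits)
    have "?win (T - s + 0) Bs' ({} \<union> D)"
    proof (rule winnable_phase[where V = "{..<n} - \<Union>D" and W = "{}" and j = a])
      \<comment> \<open>For \<open>a = 1\<close> the additional vertex is the one left over because
        \<open>n\<close> is odd.\<close>
      show "2 * a * (T - s) + 2 * (a - a) + (if a = 1 then 1 else 0) \<le> card ({..<n} - \<Union>D)"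
        using sum assms(1,2) by (auto simp: card_Diff_matching[OF D'] elim!: oddE)
    next
      fix D2 Bs2
      assume "matching_on ({..<n} - \<Union>D) (a * (T - s)) D2"
      from matching_on_Un[OF D' this, of "{..<n}"] have "matching_on {..<n} (n div 2) (D \<union> D2)"
        using sum by auto
      then show "?win 0 Bs2 ({} \<union> D \<union> D2)"
        by (auto simp: perfect_matching_game_iff winnable.simps)
    qed (use assms D in \<open>auto simp: complete_edges_def nsets_def\<close>)
    then show "?win (T - s) Bs' ({} \<union> D)" by simp
  qed (use assms in \<open>auto simp: complete_edges_def threats_def\<close>)
  then show "?win T {} {}" using s by simp
qed

section \<open>Upper bound for single edges and even order\<close>

text \<open>Maker starts with a path \<open>b - x - y\<close>. Once all but one vertex \<open>z\<close> is covered, the edges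
  \<open>{b, z}\<close> and \<open>{y, z}\<close> both complete a perfect matching, and Breaker cannot claim both at once.\<close>

lemma winnable_path_end:
  assumes P: "matching_on ({..<n} - {b, x, y}) (n div 2 - 2) P" "z < n" "z \<notin> \<Union>P"
    and path: "distinct [b, x, y, z]" "b < n" "x < n" "y < n" "4 \<le> n"
    and Ms: "{{b, x}, {x, y}} \<union> P \<subseteq> Ms" and clean: "threats {z} {b, y} Bs = {}"
  shows "winnable 1 (complete_edges n) (perfect_matching_game n) 1 Bs Ms"
proof (simp add: winnable.simps, intro allI impI)
  fix B :: "nat set set" assume "finite B \<and> card B \<le> Suc 0"
  moreover have "{b, z} \<noteq> {y, z}" using path(1) by (auto simp: doubleton_eq_iff)
  ultimately have "{b, z} \<notin> B \<or> {y, z} \<notin> B" by (metis card_le_Suc0_iff_eq)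
  moreover have "{b, z} \<notin> Bs" "{y, z} \<notin> Bs" using clean unfolding threats_def by blast+
  ultimately obtain u v where uv: "{u, z} \<notin> Bs \<union> B" "{u, v} = {b, y}" by blast
  then have "u = b \<and> v = y \<or> u = y \<and> v = b" by (simp add: doubleton_eq_iff)
  then have dist: "distinct [u, v, x, z]" and lt: "u < n" "v < n"
    using path by auto
  have P_out: "u \<notin> \<Union>P" "v \<notin> \<Union>P" "x \<notin> \<Union>P"
    using matching_on_Union[OF P(1)] uv(2) by auto
  have "matching_on {..<n} (Suc (n div 2 - 2)) (insert {v, x} P)"
    by (rule matching_on_insert[OF P(1)]) (use P_out dist lt path(3) in simp_all)
  then have "matching_on {..<n} (Suc (Suc (n div 2 - 2))) (insert {u, z} (insert {v, x} P))"
    by (rule matching_on_insert) (use P_out P(2,3) dist lt in simp_all)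
  moreover have "Suc (Suc (n div 2 - 2)) = n div 2" using path by simp
  moreover have "{v, x} \<in> {{b, x}, {x, y}}" using uv(2) by (auto simp: doubleton_eq_iff)
  ultimately have "\<exists>F\<in>perfect_matching_game n. F \<subseteq> insert {u, z} Ms"
    using Ms unfolding perfect_matching_game_iff Bex_def
    by (intro exI[of _ "insert {u, z} (insert {v, x} P)"]) auto
  moreover have "{u, z} \<in> complete_edges n"
    using lt dist P(2) unfolding complete_edges_def by auto
  ultimately show "\<exists>D\<subseteq>complete_edges n. card D \<le> Suc 0 \<and> D \<inter> (Bs \<union> B) = {} \<and>
      (\<exists>F\<in>perfect_matching_game n. F \<subseteq> Ms \<union> D)"
    using uv(1) by (intro exI[of _ "{{u, z}}"]) auto
qed

text \<open>One old threat and one new one can be met by a single edge. Then \<open>k\<close> clean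
  rounds reduce the \<open>2 * k + 1\<close> remaining vertices to \<open>z\<close>. Taking
  \<open>W = {b, y}\<close> keeps the edges from both path ends to \<open>z\<close> free.\<close>

lemma winnable_path:
  assumes n: "n = 2 * k + 6" "1 \<le> k"
    and path: "distinct [b, x, y]" "b < n" "x < n" "y < n" "{{b, x}, {x, y}} \<subseteq> Ms"
    and few: "finite (threats ({..<n} - {b, x, y}) {b, y} Bs)"
      "card (threats ({..<n} - {b, x, y}) {b, y} Bs) \<le> 1"
  shows "winnable 1 (complete_edges n) (perfect_matching_game n) (Suc (k + 1)) Bs Ms"
    (is "?win (Suc (k + 1)) Bs Ms")
proof (subst winnable.simps, intro allI impI)
  fix B :: "nat set set" assume B: "finite B \<and> card B \<le> 1"
  define V where "V = {..<n} - {b, x, y}"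
  have V: "finite V" "card V = n - 3"
    using path by (auto simp: V_def card_Diff_subset)
  define G where "G = threats V {b, y} (Bs \<union> B)"
  have "finite G" "card G \<le> 1 + 1"
  proof -
    have G: "G = threats V {b, y} Bs \<union> threats V {b, y} B"
      by (simp add: G_def threats_Un)
    have "finite (threats V {b, y} B)" "card (threats V {b, y} B) \<le> 1"
      using B threats_subset[of V "{b, y}" B]
      by (auto intro: finite_subset card_mono[THEN order_trans])
    then show "finite G" "card G \<le> 1 + 1"
      using few card_Un_le[of "threats V {b, y} Bs" "threats V {b, y} B"]
      unfolding G V_def by auto
  qed
  moreover have "g \<inter> V \<noteq> {}" if "g \<in> G" for g
    using that by (simp add: G_def threats_def)
  \<comment> \<open>Meeting two threats with one edge needs four vertices, hence
    \<open>1 \<le> k\<close>.\<close>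
  moreover have "2 * 1 + 2 \<le> card V" using V n by simp
  ultimately obtain D where D: "matching_on V 1 D" "D \<inter> G = {}" "\<forall>g\<in>G. g \<inter> \<Union>D \<noteq> {}"
    using ex_covering_matching[OF V(1), of G 1] by (metis order_refl)
  have "?win (k + 1) (Bs \<union> B) (Ms \<union> D)"
  proof (rule winnable_phase[where V = "V - \<Union>D" and W = "{b, y}" and j = 1])
    show "threats (V - \<Union>D) {b, y} (Bs \<union> B) = {}"
      using D(3) matching_on_Union[OF D(1)] by (intro threats_Diff) (auto simp: G_def V_def)
    show "2 * 1 * k + 2 * (1 - 1) + (if (1 :: nat) = 1 then 1 else 0) \<le> card (V - \<Union>D)"
      using V n by (simp add: card_Diff_matching[OF D(1)])
  next
    fix D2 Bs2
    assume D2: "matching_on (V - \<Union>D) (1 * k) D2" "threats (V - \<Union>D - \<Union>D2) {b, y} Bs2 = {}"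
    have P: "matching_on V (n div 2 - 2) (D \<union> D2)"
      using matching_on_Un[OF D(1) D2(1), of V] V n by auto
    have "card (V - \<Union>(D \<union> D2)) = 1"
      using card_Diff_matching[OF P V(1)] V n by simp
    then obtain z where z: "V - \<Union>(D \<union> D2) = {z}" by (meson card_1_singletonE)
    have "V - \<Union>D - \<Union>D2 = {z}" using z by auto
    then have "threats {z} {b, y} Bs2 = {}" using D2(2) by simp
    moreover have "z \<in> V" "z \<notin> \<Union>(D \<union> D2)" using z by blast+
    ultimately show "?win 1 Bs2 (Ms \<union> D \<union> D2)"
      using P path n by (intro winnable_path_end[of n b x y "D \<union> D2" z]) (auto simp: V_def)
  qed (use V in \<open>auto simp: V_def complete_edges_def nsets_def\<close>)
  moreover have "D \<subseteq> complete_edges n"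
    using matching_on_subset[OF D(1)] by (auto simp: V_def complete_edges_def nsets_def)
  moreover have "D \<inter> (Bs \<union> B) = {}"
    using matching_Int_threats D by (metis G_def)
  moreover have "card D \<le> 1" using matching_on_card[OF D(1)] by simp
  ultimately show "\<exists>D\<subseteq>complete_edges n. card D \<le> 1 \<and> D \<inter> (Bs \<union> B) = {} \<and>
      ?win (k + 1) (Bs \<union> B) (Ms \<union> D)"
    by blast
qed

lemma perfect_matching_upper_even:
  assumes "even n" "8 \<le> n"
  shows "maker_wins_within 1 (complete_edges n) (perfect_matching_game n) (n div 2 + 1)"
proof (rule maker_wins_withinI[OF finite_complete_edges])
  let ?win = "winnable 1 (complete_edges n) (perfect_matching_game n)"
  \<comment> \<open>The \<open>k + 4\<close> moves are two for the path, one to catch up with the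
    threats, \<open>k\<close> clean ones and the final one.\<close>
  define k where "k = n div 2 - 3"
  have k: "n = 2 * k + 6" "1 \<le> k" "n div 2 + 1 = Suc (Suc (Suc (k + 1)))"
    using assms by (auto simp: k_def elim!: evenE)
  have edge: "{u, v} \<in> complete_edges n" if "u < n" "v < n" "u \<noteq> v" for u v
    using that by (simp add: complete_edges_def)
  \<comment> \<open>The middle vertex \<open>x\<close> is put on Breaker's first edge. In the
    relaxed game that set may also miss the board's vertices altogether.\<close>
  have round2: "?win (Suc (Suc (k + 1))) B1 {{x, y}}"
    if B1: "finite B1" "card B1 \<le> 1" "\<forall>e\<in>B1. x \<in> e \<or> e \<inter> {..<n} = {}" and xy: "x < n" "y < n" "x \<noteq> y"
    for B1 x y
  proof (subst winnable.simps, intro allI impI)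
    fix B :: "nat set set" assume B: "finite B \<and> card B \<le> 1"
    have "card (B1 \<union> B) \<le> 2" using B B1 card_Un_le[of B1 B] by linarith
    moreover have "card {x, y} = 2" using xy by simp
    ultimately have "card (B1 \<union> B) + card {x, y} < card {..<n}"
      using assms by simp
    then obtain b where b: "b < n" "b \<noteq> x" "b \<noteq> y" "{b, x} \<notin> B1 \<union> B"
      using ex_partner[of "{..<n}" "B1 \<union> B" "{x, y}" x] B B1 by (auto simp: insert_commute)
    let ?V = "{..<n} - {b, x, y}"
    \<comment> \<open>A set containing \<open>x\<close> is not inside
      \<open>?V \<union> {b, y}\<close>, so Breaker's first move poses no threat.\<close>
    have "threats ?V {b, y} (B1 \<union> B) \<subseteq> B"
      using B1(3) xy b by (auto simp: threats_def)
    then have "finite (threats ?V {b, y} (B1 \<union> B))" "card (threats ?V {b, y} (B1 \<union> B)) \<le> 1"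
      using B by (auto intro: finite_subset card_mono[THEN order_trans])
    then have "?win (Suc (k + 1)) (B1 \<union> B) ({{x, y}} \<union> {{b, x}})"
      using b xy k by (intro winnable_path[of n k b x y]) auto
    then show "\<exists>D\<subseteq>complete_edges n. card D \<le> 1 \<and> D \<inter> (B1 \<union> B) = {} \<and>
        ?win (Suc (k + 1)) (B1 \<union> B) ({{x, y}} \<union> D)"
      using b edge[of b x] xy by (intro exI[of _ "{{b, x}}"]) auto
  qed
  have "?win (Suc (Suc (Suc (k + 1)))) {} {}"
  proof (subst winnable.simps, intro allI impI)
    fix B :: "nat set set" assume B: "finite B \<and> card B \<le> 1"
    obtain x where x: "x < n" "\<forall>e\<in>B. x \<in> e \<or> e \<inter> {..<n} = {}"
    proof (cases "\<exists>e\<in>B. e \<inter> {..<n} \<noteq> {}")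
      case True
      then obtain e x where "e \<in> B" "x \<in> e" "x < n" by auto
      moreover from this have "\<forall>e'\<in>B. e' = e" using B by (metis One_nat_def card_le_Suc0_iff_eq)
      ultimately show thesis using that[of x] by blast
    next
      case False
      then show thesis using that[of 0] assms by auto
    qed
    obtain y where y: "y < n" "y \<noteq> x" "{x, y} \<notin> B"
      using ex_partner[of "{..<n}" B "{x}" x] B assms by auto
    have "?win (Suc (Suc (k + 1))) ({} \<union> B) ({} \<union> {{x, y}})"
      using round2[of B x y] B x y by simp
    then show "\<exists>D\<subseteq>complete_edges n. card D \<le> 1 \<and> D \<inter> ({} \<union> B) = {} \<and>
        ?win (Suc (Suc (k + 1))) ({} \<union> B) ({} \<union> D)"
      using edge[of x y] x y by (intro exI[of _ "{{x, y}}"]) auto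
  qed
  then show "?win (n div 2 + 1) {} {}" using k(3) by simp
qed

section \<open>Lower bounds\<close>

lemma card_maker_claimed_play:
  assumes "is_maker_strategy a X \<mu>" "finite X"
  shows "card (maker_claimed (play \<beta> \<mu> t)) \<le> t * a \<and> finite (maker_claimed (play \<beta> \<mu> t))"
proof (induction t)
  case 0
  then show ?case by (simp add: claimed_Nil)
next
  case (Suc t)
  let ?M = "\<mu> (play \<beta> \<mu> t) (\<beta> (play \<beta> \<mu> t))"
  have "?M \<subseteq> X" "card ?M \<le> a"
    using assms by (auto simp: is_maker_strategy_def legal_move_def)
  moreover have "finite ?M" using calculation assms finite_subset by blast
  ultimately show ?case
    using Suc card_Un_le[of "maker_claimed (play \<beta> \<mu> t)" ?M]
    unfolding play_Suc by (auto intro: order_trans)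
qed

text \<open>Maker gains at most \<open>a\<close> edges per move and needs \<open>n div 2\<close>;
  one play against an arbitrary legal Breaker shows this.\<close>

lemma perfect_matching_lower:
  assumes "maker_wins_within a (complete_edges n) (perfect_matching_game n) t"
  shows "n div 2 \<le> t * a"
proof -
  let ?X = "complete_edges n"
  obtain \<mu> where \<mu>: "is_maker_strategy a ?X \<mu>"
    "\<And>\<beta>. is_breaker_strategy a ?X \<beta> \<Longrightarrow> \<exists>F\<in>perfect_matching_game n. F \<subseteq> maker_claimed (play \<beta> \<mu> t)"
    using assms by (auto simp: maker_wins_within_def)
  define \<beta> where "\<beta> h = (SOME B. legal_move a ?X (claimed h) B)" for h
  have "is_breaker_strategy a ?X \<beta>"
    unfolding is_breaker_strategy_def \<beta>_def by (metis ex_legal_move finite_complete_edges someI_ex)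
  then obtain F where F: "F \<in> perfect_matching_game n" "F \<subseteq> maker_claimed (play \<beta> \<mu> t)"
    using \<mu>(2) by blast
  have "card F \<le> t * a"
    using card_maker_claimed_play[OF \<mu>(1) finite_complete_edges] F(2) by (meson card_mono order_trans)
  then show ?thesis using F(1) by (simp add: perfect_matching_game_def)
qed

text \<open>To win with \<open>n div 2\<close> single edges Maker must not waste any, so before her last move all but
  two vertices are matched, and Breaker claims the edge between those two.\<close>

lemma perfect_matching_lower_even:
  assumes "even n" "2 \<le> n"
  shows "\<not> maker_wins_within 1 (complete_edges n) (perfect_matching_game n) (n div 2)"
proof
  let ?X = "complete_edges n"
  assume "maker_wins_within 1 ?X (perfect_matching_game n) (n div 2)"
  then obtain \<mu> where \<mu>: "is_maker_strategy 1 ?X \<mu>"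
    "\<And>\<beta>. is_breaker_strategy 1 ?X \<beta> \<Longrightarrow>
      \<exists>F\<in>perfect_matching_game n. F \<subseteq> maker_claimed (play \<beta> \<mu> (n div 2))"
    by (auto simp: maker_wins_within_def)
  \<comment> \<open>The vertices Maker has not touched. If they form a free edge, Breaker takes it,
    and otherwise he plays any legal move.\<close>
  define missing where "missing h = {..<n} - \<Union>(maker_claimed h)" for h :: "nat set history"
  define \<beta> where "\<beta> h = (if missing h \<in> ?X - claimed h then {missing h}
    else SOME B. legal_move 1 ?X (claimed h) B)" for h
  have "legal_move 1 ?X (claimed h) (\<beta> h)" for h
  proof (cases "missing h \<in> ?X - claimed h")
    case True
    then have "card (?X - claimed h) \<noteq> 0"
      using finite_complete_edges[of n] by (metis card_0_eq empty_iff finite_Diff)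
    then show ?thesis using True by (auto simp: legal_move_def \<beta>_def)
  next
    case False
    show ?thesis
      unfolding \<beta>_def if_not_P[OF False]
      by (rule someI_ex[OF ex_legal_move[OF finite_complete_edges]])
  qed
  then have "is_breaker_strategy 1 ?X \<beta>" by (simp add: is_breaker_strategy_def)
  then obtain F where F: "F \<in> perfect_matching_game n" "F \<subseteq> maker_claimed (play \<beta> \<mu> (n div 2))"
    using \<mu>(2) by blast
  define h where "h = play \<beta> \<mu> (n div 2 - 1)"
  define M where "M = \<mu> h (\<beta> h)"
  have fin: "finite (maker_claimed h)" "card (maker_claimed h) \<le> n div 2 - 1"
    using card_maker_claimed_play[OF \<mu>(1) finite_complete_edges, of \<beta> "n div 2 - 1"]
    by (auto simp: h_def)
  have M: "M \<subseteq> ?X - (claimed h \<union> \<beta> h)" "card M \<le> 1"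
    using \<mu>(1) by (auto simp: is_maker_strategy_def legal_move_def M_def)
  have "finite M"
    using M(1) finite_complete_edges[of n] by (meson Diff_subset finite_subset)
  note M = M this
  have "n div 2 = Suc (n div 2 - 1)" using assms by simp
  then have FM: "F \<subseteq> maker_claimed h \<union> M"
    using F(2) play_Suc(2)[of \<beta> \<mu> "n div 2 - 1"] by (simp add: h_def M_def del: play.simps)
  have mF: "matching_on {..<n} (n div 2) F" using F(1) by (simp add: perfect_matching_game_iff)
  then have cF: "card F = n div 2" by (rule matching_on_card)
  \<comment> \<open>Maker owns no more edges than \<open>F\<close> has, so all of them belong to the
    matching.\<close>
  have "card (maker_claimed h \<union> M) \<le> card F"
    using card_Un_le[of "maker_claimed h" M] fin M cF assms by auto
  then have F_eq: "F = maker_claimed h \<union> M"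
    using card_seteq[OF _ FM] fin M by auto
  have "M \<noteq> {}"
    using F_eq cF fin(2) assms by auto
  then obtain e where e: "M = {e}"
    using M(2,3) by (metis One_nat_def card_le_Suc0_iff_eq is_singletonI' is_singleton_def)
  have "card (\<Union>F) = card {..<n}"
    using card_Union_matching[OF mF] assms(1) by simp
  then have "\<Union>F = {..<n}"
    using matching_on_Union[OF mF] by (meson card_subset_eq finite_lessThan)
  moreover have "e \<inter> \<Union>(maker_claimed h) = {}"
  proof -
    have "disjnt e f" if "f \<in> maker_claimed h" for f
    proof -
      have "e \<noteq> f" using that e M(1) by (auto simp: claimed_eq)
      then show ?thesis using mF that e F_eq by (auto simp: matching_on_def pairwise_def)
    qed
    then show ?thesis by (auto simp: disjnt_def)
  qed
  ultimately have "missing h = e"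
    using F_eq e by (auto simp: missing_def)
  \<comment> \<open>The edge \<open>e\<close> was free before Breaker's move, so
    \<open>\<beta> h = {e}\<close>, and Maker could not claim it.\<close>
  then show False
    using M(1) e by (auto simp: \<beta>_def)
qed

section \<open>Arithmetic of the ceiling and conclusion\<close>

lemma tau_eqI:
  assumes "maker_wins_within a X \<F> T" "\<And>t. maker_wins_within a X \<F> t \<Longrightarrow> T \<le> t"
  shows "tau a X \<F> = enat T"
  unfolding tau_def using assms by (intro antisym Inf_lower Inf_greatest) auto

lemma nat_ceiling_divide_bounds:
  assumes "0 < d"
  shows "n \<le> d * nat \<lceil>real n / real d\<rceil>" "d * nat \<lceil>real n / real d\<rceil> < n + d"
proof -
  define c where "c = nat \<lceil>real n / real d\<rceil>"
  have "real c = of_int \<lceil>real n / real d\<rceil>"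
    by (simp add: c_def)
  then have "real n / real d \<le> real c" "real c < real n / real d + 1"
    using ceiling_correct[of "real n / real d"] by linarith+
  then have "real n \<le> real d * real c" "real d * real c < real n + real d"
    using assms by (auto simp: field_simps)
  then have "real n \<le> real (d * c)" "real (d * c) < real (n + d)" by auto
  then show "n \<le> d * nat \<lceil>real n / real d\<rceil>" "d * nat \<lceil>real n / real d\<rceil> < n + d"
    unfolding c_def of_nat_le_iff of_nat_less_iff by auto
qed

theorem theorem1p1:
  fixes a :: nat
  assumes "a \<ge> 1"
  shows "\<exists>n0::nat. \<forall>n\<ge>n0.
    tau a (complete_edges n) (perfect_matching_game n) =
      enat (if a = 1 \<and> even n then n div (2 * a) + 1
            else if 2 * a dvd n - 1 then nat \<lceil>real n / real (2 * a)\<rceil> - 1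
            else nat \<lceil>real n / real (2 * a)\<rceil>)"
proof (intro exI allI impI)
  \<comment> \<open>The term \<open>2 * (a * a)\<close> yields \<open>a \<le> T\<close>, and 8
    serves the even case of \<open>a = 1\<close>.\<close>
  fix n :: nat assume n: "2 * (a * a) + 8 \<le> n"
  define c where "c = nat \<lceil>real n / real (2 * a)\<rceil>"
  have c: "n \<le> 2 * (c * a)" "2 * (c * a) < n + 2 * a"
    using nat_ceiling_divide_bounds[of "2 * a" n] assms by (auto simp: c_def mult_ac)
  define T where "T = (if 2 * a dvd n - 1 then c - 1 else c)"
  show "tau a (complete_edges n) (perfect_matching_game n) =
      enat (if a = 1 \<and> even n then n div (2 * a) + 1
            else if 2 * a dvd n - 1 then nat \<lceil>real n / real (2 * a)\<rceil> - 1
            else nat \<lceil>real n / real (2 * a)\<rceil>)"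
  proof (cases "a = 1 \<and> even n")
    case True
    have "tau 1 (complete_edges n) (perfect_matching_game n) = enat (n div 2 + 1)"
    proof (rule tau_eqI)
      show "maker_wins_within 1 (complete_edges n) (perfect_matching_game n) (n div 2 + 1)"
        using perfect_matching_upper_even True n by simp
    next
      fix t assume t: "maker_wins_within 1 (complete_edges n) (perfect_matching_game n) t"
      then have "t \<noteq> n div 2"
        using perfect_matching_lower_even[of n] True n by auto
      then show "n div 2 + 1 \<le> t" using perfect_matching_lower[OF t] by simp
    qed
    then show ?thesis using True by simp
  next
    case False
    have T: "n div 2 \<le> T * a" "T * a < n div 2 + a"
    proof -
      have "n div 2 \<le> T * a \<and> T * a < n div 2 + a"
      proof (cases "2 * a dvd n - 1")
        case True
        then obtain q where q: "n - 1 = 2 * a * q" by blast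
        then have nq: "n = 2 * (q * a) + 1" using n by (simp add: mult_ac)
        \<comment> \<open>Here \<open>n div 2 = q * a\<close> exactly; the single leftover vertex
          raises the ceiling to \<open>q + 1\<close>.\<close>
        then have "q * a < c * a" "c * a < (q + 2) * a"
          using c assms unfolding add_mult_distrib by linarith+
        then have "q < c" "c < q + 2" by (simp_all only: mult_less_cancel2)
        then have "T = q" using True by (simp add: T_def)
        then show ?thesis using nq assms by simp
      next
        case ndvd: False
        \<comment> \<open>For odd \<open>n\<close> the ceiling bounds only give
          \<open>c * a \<le> n div 2 + a\<close>; equality would put \<open>n\<close> into the
          divisible case.\<close>
        have "c * a \<noteq> n div 2 + a" if "odd n"
        proof
          assume eq: "c * a = n div 2 + a"
          then have "n - 1 = 2 * a * (c - 1)"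
            using that assms by (auto simp: diff_mult_distrib2 mult_ac elim!: oddE)
          then show False using ndvd by simp
        qed
        then show ?thesis using c ndvd by (cases "even n") (auto simp: T_def elim!: evenE oddE)
      qed
      then show "n div 2 \<le> T * a" "T * a < n div 2 + a" by auto
    qed
    have "a * a \<le> T * a" using T(1) n by linarith
    then have "a \<le> T" using assms by simp
    have "tau a (complete_edges n) (perfect_matching_game n) = enat T"
    proof (rule tau_eqI)
      show "maker_wins_within a (complete_edges n) (perfect_matching_game n) T"
        using perfect_matching_upper[OF assms _ \<open>a \<le> T\<close> T] False assms by auto
    next
      fix t assume "maker_wins_within a (complete_edges n) (perfect_matching_game n) t"
      then have "T * a < (t + 1) * a" using perfect_matching_lower[of a n t] T by simp
      then have "T < t + 1" by (simp only: mult_less_cancel2)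
      then show "T \<le> t" by simp
    qed
    then show ?thesis using False by (auto simp: T_def c_def)
  qed
qed

end
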